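(* Let $d,k$ be positive integers and let $p_k=\log_2\binom{2k}{k}$. For every set $A\subseteq\{0,1\}^d\subset\mathbb{Z}^d$ we have $$E_k(A)\leq |A|^{p_k}.$$
   Context: For a positive integer $k$ and a finite set $A\subset\mathbb{Z}^d$, the $k$-additive energy $E_k(A)$ is the number of $2k$-tuples $(a_1,\ldots,a_{2k})\in A^{2k}$ such that $a_1+\cdots+a_k=a_{k+1}+\cdots+a_{2k}$. $|A|$ denotes the cardinality of $A$. *)

theory Defs
  imports "HOL-Analysis.Finite_Cartesian_Product" "HOL-Library.FuncSet" Complex_Main
begin

text \<open>
  Tuples are functions on \<open>{1..2 * k}\<close>; the extensional function space makes each tuple
  correspond to exactly one function, so that the cardinality counts tuples.
\<close>

definition additive_energy :: "nat \<Rightarrow> 'a::comm_monoid_add set \<Rightarrow> nat" where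
  "additive_energy k A =
     card {a \<in> {1..2 * k} \<rightarrow>\<^sub>E A. (\<Sum>i = 1..k. a i) = (\<Sum>i = k + 1..2 * k. a i)}"

definition discrete_cube :: "(int ^ 'd) set" where
  "discrete_cube = {x. \<forall>i. x $ i \<in> {0, 1}}"

end

theory Submission imports Defs "HOL-Analysis.Convex"
begin

text \<open>
  Let \<open>F\<^sub>A \<theta> = \<Sum>a\<in>A. \<theta> ^ a\<close> for \<open>\<theta>\<close> in the \<open>d\<close>-th power of the group of \<open>N\<close>-th roots of unity, \<open>N > k\<close>,
  so that \<open>E\<^sub>k(A)\<close> is the mean of \<open>\<bar>F\<^sub>A\<bar> ^ (2 * k)\<close>. Splitting \<open>A\<close> along a coordinate into nonempty
  \<open>A\<^sub>0\<close> and \<open>A\<^sub>1\<close>, orthogonality in that coordinate and Hoelder's inequality give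
  \<open>E\<^sub>k(A) \<le> (\<Sum>j\<le>k. (k choose j)\<^sup>2 * E\<^sub>k(A\<^sub>0) powr ((k - j) / k) * E\<^sub>k(A\<^sub>1) powr (j / k))\<close>.
  Induction on \<open>card A\<close> therefore reduces the theorem to a two-point inequality, which after
  \<open>\<bar>A\<^sub>0\<bar> / \<bar>A\<^sub>1\<bar> = exp (2 * c * t)\<close>, \<open>c = k / p\<^sub>k\<close>, says that
  \<open>G t = p\<^sub>k * ln (2 * cosh (c * t)) - ln (\<Sum>j\<le>k. (k choose j)\<^sup>2 * exp ((k - 2 * j) * t))\<close> is nonnegative.
  Legendre's equation shows that at a critical point \<open>t > 0\<close> of \<open>G\<close> the sign of \<open>G''\<close> is that of
  \<open>c / k - sinh ((2 * c - 1) * t) / sinh t\<close>, which is increasing in \<open>t\<close>; so no local maximum can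
  follow a local minimum. Since \<open>G 0 = 0\<close> and \<open>G\<close> tends to \<open>0\<close> from above at infinity,
  a negative value of \<open>G\<close> would produce a minimum followed by a maximum.
\<close>

section \<open>Calculus: extrema and a ratio of hyperbolic sines\<close>

text \<open>If \<open>l\<close> were negative, \<open>G'\<close> would be negative just to the right
  of \<open>x\<close>, and by the mean value theorem \<open>G\<close> would drop below its minimum.
  Applied to \<open>- G\<close>, this also serves for maxima.\<close>

lemma interior_min_second_derivative:
  fixes G G' :: "real \<Rightarrow> real"
  assumes "a < x" "x < b" and min: "\<And>y. \<lbrakk>a < y; y < b\<rbrakk> \<Longrightarrow> G x \<le> G y"
    and G: "\<And>y. (G has_real_derivative G' y) (at y)"
    and G': "(G' has_real_derivative l) (at x)"
  shows "G' x = 0" "0 \<le> l"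
proof -
  define d where "d = min (x - a) (b - x)"
  have d: "d > 0" "\<And>y. \<bar>x - y\<bar> < d \<Longrightarrow> G x \<le> G y"
    using assms(1,2) by (auto simp: d_def intro!: min)
  show zero: "G' x = 0"
    using DERIV_local_min[OF G d(1)] d(2) by blast
  show "0 \<le> l"
  proof (rule ccontr)
    assume "\<not> 0 \<le> l"
    then obtain e where e: "e > 0" "\<And>h. \<lbrakk>0 < h; h < e\<rbrakk> \<Longrightarrow> G' (x + h) < 0"
      using DERIV_neg_dec_right[OF G'] zero by auto
    define h where "h = min d e / 2"
    have h: "0 < h" "h < d" "h < e"
      using d(1) e(1) by (auto simp: h_def min_def)
    obtain z where "x < z" "z < x + h" "G (x + h) - G x = (x + h - x) * G' z"
      using MVT2[of x "x + h" G G'] h G by auto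
    moreover from this have "G' z < 0"
      using e(2)[of "z - x"] h by simp
    ultimately have "G (x + h) < G x"
      using h(1) by (smt (verit) mult_pos_neg)
    moreover have "G x \<le> G (x + h)"
      using d(2)[of "x + h"] h by simp
    ultimately show False by simp
  qed
qed

text \<open>The numerator \<open>w\<close> of the derivative of the ratio vanishes at 0 and is
  itself decreasing on the positive axis, because \<open>b\<^sup>2 < 1\<close>.\<close>

lemma sinh_ratio_strict_decreasing:
  fixes b s t :: real
  assumes b: "0 < b" "b < 1" and st: "0 < s" "s < t"
  shows "sinh (b * t) / sinh t < sinh (b * s) / sinh s"
proof -
  define w where "w x = b * cosh (b * x) * sinh x - sinh (b * x) * cosh x" for x
  have w: "w x < 0" if "x > 0" for x
  proof -
    have w': "(w has_real_derivative (b\<^sup>2 - 1) * (sinh (b * y) * sinh y)) (at y)" for y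
      unfolding w_def
      by (rule derivative_eq_intros refl | simp add: algebra_simps power2_eq_square)+
    obtain z where "0 < z" "z < x" "w x - w 0 = (x - 0) * ((b\<^sup>2 - 1) * (sinh (b * z) * sinh z))"
      using MVT2[of 0 x w "\<lambda>y. (b\<^sup>2 - 1) * (sinh (b * y) * sinh y)"] \<open>x > 0\<close> w' by blast
    moreover have "(b\<^sup>2 - 1) * (sinh (b * z) * sinh z) < 0" if "z > 0" for z
      using that b by (simp add: mult_less_0_iff power_less_one_iff)
    ultimately show ?thesis
      using \<open>x > 0\<close> by (simp add: w_def mult_less_0_iff)
  qed
  have "\<exists>y. ((\<lambda>x. sinh (b * x) / sinh x) has_real_derivative y) (at x) \<and> y < 0"
    if "s \<le> x" "x \<le> t" for x
  proof -
    have x: "x > 0" using that st by simp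
    then have "((\<lambda>x. sinh (b * x) / sinh x) has_real_derivative w x / (sinh x)\<^sup>2) (at x)"
      unfolding w_def
      by (auto intro!: derivative_eq_intros simp: power2_eq_square field_simps)
    with w[OF x] x show ?thesis by (intro exI) (auto simp: divide_neg_pos)
  qed
  then show ?thesis using DERIV_neg_imp_decreasing[OF st(2)] by blast
qed

section \<open>Sums of squared binomial coefficients\<close>

text \<open>The index \<open>n\<close> counts derivatives in \<open>t\<close>. For
  \<open>n = 0\<close> the factor \<open>0 ^ 0 = 1\<close> keeps the middle term of even
  \<open>k\<close>. For \<open>t \<noteq> 0\<close>, \<open>cbsum k 0 t\<close> is
  \<open>(2 * sinh t) ^ k\<close> times the Legendre polynomial of degree \<open>k\<close> at
  \<open>coth t\<close>.\<close>

definition cbsum :: "nat \<Rightarrow> nat \<Rightarrow> real \<Rightarrow> real" where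
  "cbsum k n t = (\<Sum>j\<le>k. (real (k choose j))\<^sup>2 * (real k - 2 * real j) ^ n * exp ((real k - 2 * real j) * t))"

lemma has_derivative_cbsum:
  "(cbsum k n has_real_derivative cbsum k (Suc n) t) (at t)"
  unfolding cbsum_def by (rule derivative_eq_intros refl | simp add: mult_ac)+

lemma cbsum_pos: "cbsum k 0 t > 0"
  unfolding cbsum_def by (intro sum_pos) auto

lemma cbsum_minus: "cbsum k 0 (- t) = cbsum k 0 t"
  unfolding cbsum_def
  by (rule sum.reindex_bij_witness[of _ "\<lambda>j. k - j" "\<lambda>j. k - j"])
     (auto simp: binomial_symmetric[symmetric] of_nat_diff algebra_simps)

lemma cbsum_zero: "cbsum k 0 0 = real ((2 * k) choose k)"
proof -
  have "cbsum k 0 0 = real (\<Sum>j\<le>k. (k choose j)\<^sup>2)"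
    by (simp add: cbsum_def)
  then show ?thesis by (simp only: choose_square_sum)
qed

text \<open>This is Legendre's differential equation in hyperbolic coordinates, since
  \<open>\<Sum>j. (k choose j)\<^sup>2 * x ^ j = (1 - x) ^ k * P\<^sub>k ((1 + x) / (1 - x))\<close>.\<close>
lemma cbsum_ode:
  "sinh t * cbsum k 2 t - 2 * real k * cosh t * cbsum k 1 t + (real k)\<^sup>2 * sinh t * cbsum k 0 t = 0"
proof -
  define c where "c j = (real (k choose j))\<^sup>2" for j
  \<comment> \<open>Expanding \<open>sinh\<close> and \<open>cosh\<close> into exponentials shifts
    each exponent by one up or down. The coefficients of the two kinds of terms become the perfect
    squares in \<open>f\<close> and \<open>g\<close>, up to the factors 2 and -2.\<close>
  define f where "f j = c j * (real j)\<^sup>2 * exp ((real k - 2 * real j + 1) * t)" for j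
  define g where "g j = c j * (real k - real j)\<^sup>2 * exp ((real k - 2 * real j - 1) * t)" for j
  have fg: "f (Suc j) = g j" if "j < k" for j
  proof -
    have "Suc j * (k choose Suc j) = (k - j) * (k choose j)"
      by (metis binomial_absorb_comp binomial_absorption)
    then have "real (Suc j * (k choose Suc j)) = real ((k - j) * (k choose j))" by (rule arg_cong)
    then have "real (Suc j) * real (k choose Suc j) = (real k - real j) * real (k choose j)"
      using that by (simp add: of_nat_diff distrib_right)
    then have "(real (Suc j) * real (k choose Suc j))\<^sup>2 = ((real k - real j) * real (k choose j))\<^sup>2"
      by simp
    then have "c (Suc j) * (real (Suc j))\<^sup>2 = c j * (real k - real j)\<^sup>2"
      unfolding c_def power_mult_distrib by (simp add: mult_ac)
    moreover have "real k - 2 * real (Suc j) + 1 = real k - 2 * real j - 1" by simp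
    ultimately show ?thesis unfolding f_def g_def by simp
  qed
  \<comment> \<open>The boundary terms \<open>f 0\<close> and \<open>g k\<close> vanish, so the
    index shift \<open>fg\<close> matches the two sums.\<close>
  have "(\<Sum>j\<le>k. f j) = f 0 + (\<Sum>j<k. f (Suc j))"
    by (simp add: sum.atMost_shift)
  also have "\<dots> = (\<Sum>j<k. g j)"
    using fg by (simp add: f_def)
  also have "\<dots> = (\<Sum>j\<le>k. g j)"
    by (simp add: lessThan_Suc_atMost[symmetric] g_def)
  finally have eq: "(\<Sum>j\<le>k. f j) = (\<Sum>j\<le>k. g j)" .
  have "sinh t * cbsum k 2 t - 2 * real k * cosh t * cbsum k 1 t + (real k)\<^sup>2 * sinh t * cbsum k 0 t
     = (\<Sum>j\<le>k. 2 * f j - 2 * g j)"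
    unfolding cbsum_def sum_distrib_left sum_subtractf[symmetric] sum.distrib[symmetric]
  proof (rule sum.cong[OF refl])
    fix j
    define e where "e = exp ((real k - 2 * real j) * t)"
    have "f j = c j * (real j)\<^sup>2 * (e * exp t)"
      unfolding f_def e_def exp_add[symmetric] by (simp add: algebra_simps)
    moreover have "g j = c j * (real k - real j)\<^sup>2 * (e * exp (- t))"
      unfolding g_def e_def exp_add[symmetric] by (simp add: algebra_simps)
    ultimately show "sinh t * ((real (k choose j))\<^sup>2 * (real k - 2 * real j)\<^sup>2 * exp ((real k - 2 * real j) * t)) -
         2 * real k * cosh t * ((real (k choose j))\<^sup>2 * (real k - 2 * real j) ^ 1 * exp ((real k - 2 * real j) * t)) +
         (real k)\<^sup>2 * sinh t * ((real (k choose j))\<^sup>2 * (real k - 2 * real j) ^ 0 * exp ((real k - 2 * real j) * t)) =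
         2 * f j - 2 * g j"
      unfolding c_def[symmetric] e_def[symmetric] sinh_field_def cosh_field_def
      by (simp add: field_simps power2_eq_square)
  qed
  also have "\<dots> = 0"
    using eq by (simp add: sum_subtractf sum_distrib_left[symmetric])
  finally show ?thesis .
qed

section \<open>The inequality in one variable\<close>

text \<open>The full row sum is \<open>4 ^ k\<close> and contains another positive term. This yields
  \<open>p < 2 * k\<close>, that is \<open>c > 1 / 2\<close>.\<close>

lemma central_binomial_less: "k \<ge> 1 \<Longrightarrow> (2 * k) choose k < 4 ^ k"
proof -
  assume "k \<ge> 1"
  then have "((2 * k) choose k) < ((2 * k) choose 0) + ((2 * k) choose k)" by simp
  also have "\<dots> = (\<Sum>j\<in>{0, k}. (2 * k) choose j)" using \<open>k \<ge> 1\<close> by simp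
  also have "\<dots> \<le> (\<Sum>j\<le>2 * k. (2 * k) choose j)" by (rule sum_mono2) auto
  also have "\<dots> = 4 ^ k" unfolding choose_row_sum by (simp add: power_mult)
  finally show ?thesis .
qed

text \<open>Squaring the entries of row \<open>k\<close> strictly increases the one at 1 as soon as
  \<open>k \<ge> 2\<close>; for \<open>k = 1\<close> both sides equal 2. This yields
  \<open>p > k\<close>, that is \<open>c < 1\<close>.\<close>

lemma central_binomial_greater: "k \<ge> 2 \<Longrightarrow> 2 ^ k < (2 * k) choose k"
proof -
  assume k: "k \<ge> 2"
  have "2 ^ k = (\<Sum>j\<le>k. k choose j)" by (simp add: choose_row_sum)
  also have "\<dots> < (\<Sum>j\<le>k. (k choose j)\<^sup>2)"
  proof (rule sum_strict_mono_ex1)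
    show "\<exists>j\<in>{..k}. k choose j < (k choose j)\<^sup>2"
      using k by (intro bexI[of _ 1]) (auto simp: power2_eq_square)
  qed (auto simp: power2_eq_square Suc_le_eq)
  also have "\<dots> = (2 * k) choose k" by (rule choose_square_sum)
  finally show ?thesis .
qed

text \<open>The choice of \<open>p\<close> gives equality at \<open>t = 0\<close>, and
  \<open>p * c = k\<close> gives both sides the same leading term \<open>k * t\<close> at infinity.
  Between these ends the extrema of the difference are excluded by their second derivatives.\<close>

lemma cbsum_le_cosh:
  fixes p c t :: real
  assumes k: "k \<ge> 2" and p_def: "p = log 2 (real ((2 * k) choose k))" and c_def: "c = k / p"
    and t: "t \<ge> 0"
  shows "ln (cbsum k 0 t) \<le> p * ln (2 * cosh (c * t))"
proof -
  have kp: "real k < p"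
  proof -
    have "real (2 ^ k) < real ((2 * k) choose k)"
      using central_binomial_greater[OF k] by (rule of_nat_less_iff[THEN iffD2])
    then have "log 2 (2 ^ k) < p" unfolding p_def by (subst log_less_cancel_iff) auto
    then show ?thesis by simp
  qed
  have p2k: "p < 2 * real k"
  proof -
    have "real ((2 * k) choose k) < real (4 ^ k)"
      using central_binomial_less[of k] k by (intro of_nat_less_iff[THEN iffD2]) simp
    then have "p < log 2 (4 ^ k)" unfolding p_def using k by (subst log_less_cancel_iff) auto
    also have "log 2 (4 ^ k :: real) = log 2 (2 ^ (2 * k))" by (simp add: power_mult)
    finally show ?thesis by (simp del: power_mult)
  qed
  \<comment> \<open>The lower bound on \<open>c\<close> puts \<open>2 * c - 1\<close> in the range
    of \<open>sinh_ratio_strict_decreasing\<close>; the upper bound decides the sign of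
    \<open>G\<close> at infinity.\<close>
  have p: "p > 0" and c: "0 < c" "c < 1" "1 / 2 < c" and pc: "p * c = k"
    using kp p2k k by (auto simp: c_def field_simps)
  define G where "G t = p * ln (2 * cosh (c * t)) - ln (cbsum k 0 t)" for t
  define G1 where "G1 t = k * tanh (c * t) - cbsum k 1 t / cbsum k 0 t" for t
  define G2 where "G2 t = k * c * (1 - (tanh (c * t))\<^sup>2)
      - (cbsum k 2 t * cbsum k 0 t - (cbsum k 1 t)\<^sup>2) / (cbsum k 0 t)\<^sup>2" for t
  have G: "(G has_real_derivative G1 t) (at t)" for t
  proof -
    have "(G has_real_derivative p * (2 * (sinh (c * t) * c) / (2 * cosh (c * t)))
        - cbsum k (Suc 0) t / cbsum k 0 t) (at t)"
      unfolding G_def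
      by (auto intro!: derivative_eq_intros has_derivative_cbsum[THEN DERIV_chain2]
            has_derivative_cbsum simp: cbsum_pos)
    moreover have "p * (2 * (sinh (c * t) * c) / (2 * cosh (c * t))) = k * tanh (c * t)"
      using pc by (simp add: tanh_def field_simps)
    ultimately show ?thesis by (simp add: G1_def)
  qed
  have G1: "(G1 has_real_derivative G2 t) (at t)" for t
    unfolding G1_def G2_def using cbsum_pos[of k t]
    by (auto intro!: derivative_eq_intros has_derivative_cbsum
         simp: numeral_2_eq_2 power2_eq_square algebra_simps)
  \<comment> \<open>At a critical point \<open>cbsum k 1 t\<close> is
    \<open>k * tanh (c * t)\<close> times \<open>cbsum k 0 t\<close>. Legendre's equation then
    expresses \<open>cbsum k 2 t\<close> by \<open>cbsum k 0 t\<close> too, and all values of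
    \<open>cbsum\<close> cancel.\<close>
  have critical: "(cosh (c * t))\<^sup>2 * sinh t * G2 t = k * (c * sinh t - k * sinh ((2 * c - 1) * t))"
    if "t > 0" "G1 t = 0" for t
  proof -
    define P C S where "P = cbsum k 0 t" and "C = cosh (c * t)" and "S = sinh (c * t)"
    have pos: "P > 0" "C > 0" by (auto simp: P_def C_def cbsum_pos)
    have CS: "C\<^sup>2 = S\<^sup>2 + 1" unfolding C_def S_def by (rule cosh_square_eq)
    have P1: "cbsum k 1 t = k * (S / C) * P"
      using that(2) pos by (simp add: G1_def tanh_def P_def C_def S_def field_simps)
    have P2: "sinh t * cbsum k 2 t = 2 * k * cosh t * (k * (S / C) * P) - k\<^sup>2 * sinh t * P"
      using cbsum_ode[of t k] unfolding P1 P_def[symmetric] by simp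
    have "sinh t * G2 t = k * c * (1 - (S / C)\<^sup>2) * sinh t
      - (sinh t * cbsum k 2 t) / P + sinh t * (k * (S / C))\<^sup>2"
      using pos unfolding G2_def P1 P_def[symmetric] tanh_def C_def[symmetric] S_def[symmetric]
      by (simp add: field_simps power2_eq_square)
    also have "\<dots> = k * c * (1 - (S / C)\<^sup>2) * sinh t
      - (2 * k * cosh t * (k * (S / C)) - k\<^sup>2 * sinh t) + sinh t * (k * (S / C))\<^sup>2"
      unfolding P2 using pos by (simp add: field_simps)
    finally have G2: "sinh t * G2 t = k * c * (1 - (S / C)\<^sup>2) * sinh t
      - (2 * k * cosh t * (k * (S / C)) - k\<^sup>2 * sinh t) + sinh t * (k * (S / C))\<^sup>2" .
    define r where "r = S / C"
    have r: "S = C * r" using pos by (simp add: r_def)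
    have "C\<^sup>2 * (sinh t * G2 t) = k * c * (C\<^sup>2 - S\<^sup>2) * sinh t
      - (2 * k\<^sup>2 * cosh t * S * C - k\<^sup>2 * sinh t * C\<^sup>2) + sinh t * k\<^sup>2 * S\<^sup>2"
      unfolding G2 r_def[symmetric] unfolding r by (simp add: algebra_simps power2_eq_square)
    also have "\<dots> = k * c * sinh t - k\<^sup>2 * (2 * S * C * cosh t - (C\<^sup>2 + S\<^sup>2) * sinh t)"
      unfolding CS by (simp add: algebra_simps)
    also have "2 * S * C * cosh t - (C\<^sup>2 + S\<^sup>2) * sinh t = sinh (2 * (c * t) - t)"
      unfolding sinh_diff sinh_double cosh_double C_def S_def by simp
    finally show ?thesis
      unfolding C_def by (simp add: algebra_simps power2_eq_square)
  qed
  have G0: "G 0 = 0"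
    by (simp add: G_def cbsum_zero p_def log_def)
  \<comment> \<open>Both logarithms lose their common leading term \<open>k * t\<close>; what
    remains are logarithms of quantities tending to 1.\<close>
  have tail: "G t = p * ln (1 + exp (- 2 * c * t)) - ln (cbsum k 0 t * exp (- real k * t))" for t :: real
  proof -
    have "2 * cosh (c * t) = exp (c * t) * (1 + exp (- 2 * c * t))"
      unfolding cosh_field_def by (simp add: distrib_left exp_add[symmetric])
    then have "ln (2 * cosh (c * t)) = c * t + ln (1 + exp (- 2 * c * t))"
      using add_pos_pos[OF zero_less_one exp_gt_zero, of "- 2 * c * t"]
      by (simp add: ln_mult less_imp_neq[symmetric])
    then have "p * ln (2 * cosh (c * t)) = k * t + p * ln (1 + exp (- 2 * c * t))"
      using pc by (simp add: distrib_left mult.assoc[symmetric])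
    moreover have "ln (cbsum k 0 t * exp (- real k * t)) = ln (cbsum k 0 t) - k * t"
      using cbsum_pos[of k t] by (simp add: ln_mult)
    ultimately show ?thesis by (simp add: G_def)
  qed
  define B where "B = real ((2 * k) choose k)"
  \<comment> \<open>After normalisation the term \<open>j = 0\<close> is 1 and every other
    exponential is at most \<open>exp (- 2 * t)\<close>; \<open>B\<close> dominates the sum of their
    coefficients.\<close>
  have bounds: "1 \<le> cbsum k 0 t * exp (- real k * t)" "cbsum k 0 t * exp (- real k * t) \<le> 1 + B * exp (- 2 * t)"
    if "t \<ge> 0" for t
  proof -
    have eq: "cbsum k 0 t * exp (- real k * t) = (\<Sum>j\<le>k. (real (k choose j))\<^sup>2 * exp (- 2 * real j * t))"
      unfolding cbsum_def sum_distrib_right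
      by (intro sum.cong) (auto simp: mult.assoc exp_add[symmetric] algebra_simps)
    also have "\<dots> = 1 + (\<Sum>j<k. (real (k choose Suc j))\<^sup>2 * exp (- 2 * real (Suc j) * t))"
      by (subst sum.atMost_shift) (simp del: of_nat_Suc add: One_nat_def[symmetric] del: One_nat_def)
    finally have 1: "cbsum k 0 t * exp (- real k * t) = 1 + (\<Sum>j<k. (real (k choose Suc j))\<^sup>2 * exp (- 2 * real (Suc j) * t))" .
    show "1 \<le> cbsum k 0 t * exp (- real k * t)"
      unfolding 1 by (simp add: sum_nonneg)
    have "(\<Sum>j<k. (real (k choose Suc j))\<^sup>2 * exp (- 2 * real (Suc j) * t))
      \<le> (\<Sum>j<k. (real (k choose Suc j))\<^sup>2 * exp (- 2 * t))"
      using that by (intro sum_mono mult_left_mono) (auto simp: algebra_simps)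
    also have "\<dots> = (\<Sum>j<k. (real (k choose Suc j))\<^sup>2) * exp (- 2 * t)"
      by (simp add: sum_distrib_right)
    also have "(\<Sum>j<k. (real (k choose Suc j))\<^sup>2) \<le> (\<Sum>j\<le>k. (real (k choose j))\<^sup>2)"
      by (simp add: sum.atMost_shift)
    also have "\<dots> = B"
      using cbsum_zero[of k] by (simp add: B_def cbsum_def)
    finally show "cbsum k 0 t * exp (- real k * t) \<le> 1 + B * exp (- 2 * t)"
      unfolding 1 by simp
  qed
  have upper: "G t \<le> p * exp (- 2 * c * t)" if "t \<ge> 0" for t
  proof -
    have "ln (1 + exp (- 2 * c * t)) \<le> exp (- 2 * c * t)"
      by (rule ln_add_one_self_le_self) simp
    moreover have "0 \<le> ln (cbsum k 0 t * exp (- real k * t))"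
      using bounds(1)[OF that] by (rule ln_ge_zero)
    ultimately show ?thesis
      unfolding tail using p by (smt (verit) mult_left_mono)
  qed
  have lower: "p / 2 * exp (- 2 * c * t) - B * exp (- 2 * t) \<le> G t" if "t \<ge> 0" for t
  proof -
    define y where "y = exp (- 2 * c * t)"
    have y: "0 < y" "y \<le> 1" using c that by (auto simp: y_def)
    \<comment> \<open>The bound \<open>ln (1 + y) \<ge> y / (1 + y)\<close> is
      \<open>ln x \<le> x - 1\<close> at \<open>x = inverse (1 + y)\<close>.\<close>
    have "y / 2 \<le> y / (1 + y)" using y by (intro divide_left_mono) auto
    also have "\<dots> = 1 - inverse (1 + y)" using y by (simp add: field_simps)
    also have "\<dots> \<le> ln (1 + y)"
      using ln_le_minus_one[of "inverse (1 + y)"] y by (simp add: ln_inverse)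
    finally have "p * (y / 2) \<le> p * ln (1 + y)" using p by simp
    moreover have "ln (cbsum k 0 t * exp (- real k * t)) \<le> B * exp (- 2 * t)"
      using ln_le_minus_one[of "cbsum k 0 t * exp (- real k * t)"] bounds[OF that] by simp
    ultimately show ?thesis unfolding tail y_def by simp
  qed
  have "\<forall>\<^sub>F t in at_top. B * exp (- 2 * (1 - c) * t) < p / 2"
  proof -
    have "((\<lambda>t. B * exp (- 2 * (1 - c) * t)) \<longlongrightarrow> B * 0) at_top"
      using c by (intro tendsto_intros filterlim_compose[OF exp_at_bot]
        filterlim_tendsto_neg_mult_at_bot[OF tendsto_const] filterlim_ident) auto
    then show ?thesis using p by (intro order_tendstoD) auto
  qed
  then have pos: "\<forall>\<^sub>F t in at_top. G t > 0"
    using eventually_ge_at_top[of 0]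
  proof eventually_elim
    case (elim t)
    \<comment> \<open>Since \<open>c < 1\<close>, \<open>exp (- 2 * t)\<close> is of smaller order
      than \<open>exp (- 2 * c * t)\<close>, so the positive term of \<open>lower\<close> wins
      eventually.\<close>
    have "B * exp (- 2 * t) = B * exp (- 2 * (1 - c) * t) * exp (- 2 * c * t)"
      by (simp add: mult.assoc exp_add[symmetric] algebra_simps)
    also have "\<dots> < p / 2 * exp (- 2 * c * t)"
      using elim by (intro mult_strict_right_mono) auto
    finally show ?case using lower[OF elim(2)] by simp
  qed
  have small: "\<forall>\<^sub>F t in at_top. G t < e" if "e > 0" for e
  proof -
    have "((\<lambda>t. p * exp (- 2 * c * t)) \<longlongrightarrow> p * 0) at_top"
      using c by (intro tendsto_intros filterlim_compose[OF exp_at_bot]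
        filterlim_tendsto_neg_mult_at_bot[OF tendsto_const] filterlim_ident) auto
    then have "\<forall>\<^sub>F t in at_top. p * exp (- 2 * c * t) < e"
      using that by (intro order_tendstoD) auto
    then show ?thesis using eventually_ge_at_top[of 0]
      by eventually_elim (use upper in fastforce)
  qed
  have cont: "continuous_on X G" for X
    using G by (meson DERIV_isCont continuous_at_imp_continuous_on)
  have "0 \<le> G t"
  proof (rule ccontr)
    assume neg: "\<not> 0 \<le> G t"
    then have "t > 0" using t G0 by (cases "t = 0") auto
    \<comment> \<open>The point \<open>b\<close> bounds the search for a minimum. The point
      \<open>b'\<close> beyond it, where \<open>G\<close> is smaller again, bounds the search for a
      maximum.\<close>
    obtain b where b: "b > t" "G b > 0"
      using eventually_happens'[OF _ eventually_conj[OF pos eventually_gt_at_top[of t]]] by auto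
    obtain b' where b': "b' > b" "G b' < G b"
      using eventually_happens'[OF _ eventually_conj[OF small[OF b(2)] eventually_gt_at_top[of b]]] by auto
    obtain t0 where t0: "t0 \<in> {0..b}" "\<And>y. y \<in> {0..b} \<Longrightarrow> G t0 \<le> G y"
      using continuous_attains_inf[of "{0..b}" G] cont \<open>t > 0\<close> b by auto
    \<comment> \<open>The minimum is negative while \<open>G 0 = 0 < G b\<close>, so it is attained
      in the interior.\<close>
    have t0neg: "G t0 < 0" using t0(2)[of t] neg \<open>t > 0\<close> b by auto
    have t0': "0 < t0" "t0 < b" using t0(1) t0neg G0 b by (auto simp: order_le_less)
    have "G1 t0 = 0" "0 \<le> G2 t0"
      using interior_min_second_derivative[of 0 t0 b G G1 "G2 t0"] t0(2) t0' G G1 by auto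
    then have "0 \<le> k * (c * sinh t0 - k * sinh ((2 * c - 1) * t0))"
      using critical[of t0] t0' by (simp flip: critical)
    then have 1: "sinh ((2 * c - 1) * t0) / sinh t0 \<le> c / k"
      using k t0' by (simp add: zero_le_mult_iff field_simps)
    obtain t1 where t1: "t1 \<in> {t0..b'}" "\<And>y. y \<in> {t0..b'} \<Longrightarrow> G y \<le> G t1"
      using continuous_attains_sup[of "{t0..b'}" G] cont t0' b' by auto
    \<comment> \<open>The maximum is at least \<open>G b\<close>, which exceeds \<open>G\<close> at
      both ends \<open>t0\<close> and \<open>b'\<close>; hence it is interior as well.\<close>
    have "G b \<le> G t1" using t1(2)[of b] t0' b' by simp
    then have t1': "t0 < t1" "t1 < b'" using t1(1) t0neg b b' by (auto simp: order_le_less)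
    have "- G1 t1 = 0" "0 \<le> - G2 t1"
      using interior_min_second_derivative[of t0 t1 b' "\<lambda>t. - G t" "\<lambda>t. - G1 t" "- G2 t1"]
        t1(2) t1' G G1 by (auto intro: DERIV_minus)
    then have "(cosh (c * t1))\<^sup>2 * sinh t1 * G2 t1 \<le> 0"
      using t0' t1' by (intro mult_nonneg_nonpos) auto
    then have "k * (c * sinh t1 - k * sinh ((2 * c - 1) * t1)) \<le> 0"
      using critical[of t1] \<open>- G1 t1 = 0\<close> t0' t1' by simp
    then have 2: "c / k \<le> sinh ((2 * c - 1) * t1) / sinh t1"
      using k t0' t1' by (simp add: mult_le_0_iff field_simps)
    show False
      using sinh_ratio_strict_decreasing[of "2 * c - 1" t0 t1] 1 2 c t0' t1' by simp
  qed
  then show ?thesis by (simp add: G_def)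
qed

section \<open>The two-point inequality\<close>

text \<open>Writing \<open>a\<close> and \<open>b\<close> as exponentials of
  \<open>m + c * t\<close> and \<open>m - c * t\<close>, both sides are homogeneous with common
  factor \<open>exp (m * p)\<close>. Evenness in \<open>t\<close> then reduces the claim to
  \<open>cbsum_le_cosh\<close>.\<close>

lemma two_point_inequality:
  fixes a b :: real
  assumes k: "k \<ge> 1" and a: "a > 0" and b: "b > 0" and p_def: "p = log 2 (real ((2 * k) choose k))"
  shows "(\<Sum>j\<le>k. (real (k choose j))\<^sup>2 * ((a powr (p / k)) ^ (k - j) * (b powr (p / k)) ^ j))
    \<le> (a + b) powr p"
\<comment> \<open>For \<open>k = 1\<close> the exponent \<open>p\<close> is 1 and both sides are
  \<open>a + b\<close>.\<close>
proof (cases "k = 1")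
  case True
  then show ?thesis using a b by (simp add: p_def)
next
  case False
  with k have k2: "k \<ge> 2" by simp
  have p: "p > 0"
    using central_binomial_greater[OF k2] one_less_power[of "2 :: nat" k] k unfolding p_def
    by (subst zero_less_log_cancel_iff) auto
  define c where "c = k / p"
  have c: "c > 0" using k p by (simp add: c_def)
  define m where "m = (ln a + ln b) / 2"
  define t where "t = (ln a - ln b) / (2 * c)"
  have ab: "a = exp (m + c * t)" "b = exp (m - c * t)"
    using a b c by (simp_all add: m_def t_def field_simps)
  have lnab: "ln a = m + c * t" "ln b = m - c * t"
    by (simp_all add: ab)
  have "(\<Sum>j\<le>k. (real (k choose j))\<^sup>2 * ((a powr (p / k)) ^ (k - j) * (b powr (p / k)) ^ j))
    = exp (m * p) * cbsum k 0 t"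
    unfolding cbsum_def sum_distrib_left
  proof (rule sum.cong[OF refl])
    fix j assume "j \<in> {..k}"
    then have j: "real (k - j) = real k - real j" by (simp add: of_nat_diff)
    have "(a powr (p / k)) ^ (k - j) * (b powr (p / k)) ^ j
      = exp (real (k - j) * (p / k * (m + c * t)) + real j * (p / k * (m - c * t)))"
      using a b unfolding exp_add exp_of_nat_mult by (simp add: powr_def lnab)
    also have "real (k - j) * (p / k * (m + c * t)) + real j * (p / k * (m - c * t))
       = m * p + (real k - 2 * real j) * t"
      unfolding j using k p by (simp add: c_def field_simps)
    finally show "(real (k choose j))\<^sup>2 * ((a powr (p / k)) ^ (k - j) * (b powr (p / k)) ^ j) =
      exp (m * p) * ((real (k choose j))\<^sup>2 * (real k - 2 * real j) ^ 0 * exp ((real k - 2 * real j) * t))"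
      by (simp add: exp_add)
  qed
  also have "cbsum k 0 t = cbsum k 0 \<bar>t\<bar>"
    by (simp add: abs_if cbsum_minus)
  also have "\<dots> = exp (ln (cbsum k 0 \<bar>t\<bar>))" by (simp add: cbsum_pos)
  also have "\<dots> \<le> exp (p * ln (2 * cosh (c * \<bar>t\<bar>)))"
    using cbsum_le_cosh[OF k2 p_def c_def, of "\<bar>t\<bar>"] by simp
  also have "cosh (c * \<bar>t\<bar>) = cosh (c * t)"
    by (simp add: abs_if)
  also have "exp (m * p) * exp (p * ln (2 * cosh (c * t))) = (a + b) powr p"
  proof -
    have "a + b = exp m * (2 * cosh (c * t))"
      by (simp add: ab cosh_field_def exp_add exp_diff exp_minus field_simps)
    then show ?thesis
      by (simp add: powr_def ln_mult exp_add[symmetric] algebra_simps)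
  qed
  finally show ?thesis by simp
qed

section \<open>Characters on a finite torus\<close>

text \<open>Exponents are integers rather than naturals because conjugation negates them.\<close>

definition char_eval :: "int ^ 'd \<Rightarrow> ('d::finite \<Rightarrow> complex) \<Rightarrow> complex" where
  "char_eval a \<theta> = (\<Prod>i\<in>UNIV. \<theta> i powi (a $ i))"

text \<open>This finite group stands in for the torus, so that integrals become finite sums.
  Orthogonality survives as long as exponents stay below \<open>N\<close> in absolute value.\<close>

definition root_torus :: "nat \<Rightarrow> ('d::finite \<Rightarrow> complex) set" where
  "root_torus N = (UNIV \<rightarrow>\<^sub>E {z. z ^ N = 1})"

definition exp_sum :: "(int ^ 'd) set \<Rightarrow> ('d::finite \<Rightarrow> complex) \<Rightarrow> complex" where
  "exp_sum A \<theta> = (\<Sum>a\<in>A. char_eval a \<theta>)"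

lemma finite_root_torus: "N > 0 \<Longrightarrow> finite (root_torus N)"
  unfolding root_torus_def by (intro finite_PiE finite_roots_unity) auto

lemma card_root_torus_pos: "N > 0 \<Longrightarrow> card (root_torus N) > 0"
proof -
  assume N: "N > 0"
  have "(\<lambda>_. 1) \<in> root_torus N" by (auto simp: root_torus_def PiE_def extensional_def)
  then show ?thesis using finite_root_torus[OF N] by (auto simp: card_gt_0_iff)
qed

lemma root_torusD:
  assumes "\<theta> \<in> root_torus N" "N > 0"
  shows "\<theta> i \<noteq> 0" "norm (\<theta> i) = 1" "cnj (\<theta> i) = inverse (\<theta> i)"
proof -
  have *: "\<theta> i ^ N = 1" using assms(1) by (auto simp: root_torus_def PiE_def Pi_def)
  show "norm (\<theta> i) = 1"
    using arg_cong[OF *, of norm] assms(2)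
    by (intro power_eq_imp_eq_base[of _ N 1]) (simp_all add: norm_power)
  then show "\<theta> i \<noteq> 0" by auto
  show "cnj (\<theta> i) = inverse (\<theta> i)"
    using complex_norm_square[of "\<theta> i"] \<open>norm (\<theta> i) = 1\<close> by (simp add: inverse_unique)
qed

lemma char_eval_sum:
  assumes "\<theta> \<in> root_torus N" "N > 0" "finite I"
  shows "char_eval (\<Sum>i\<in>I. a i) \<theta> = (\<Prod>i\<in>I. char_eval (a i) \<theta>)"
  using assms(3)
proof induction
  case empty
  show ?case by (simp add: char_eval_def)
next
  case (insert x F)
  then show ?case
    using root_torusD[OF assms(1,2)]
    by (simp add: char_eval_def power_int_add prod.distrib)
qed

lemma cnj_char_eval:
  assumes "\<theta> \<in> root_torus N" "N > 0"
  shows "cnj (char_eval a \<theta>) = char_eval (- a) \<theta>"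
  using root_torusD[OF assms]
  by (simp add: char_eval_def power_int_minus power_int_inverse)

text \<open>Multiplying one coordinate by a root of unity permutes the group. Every cancellation of
  character sums below comes from this invariance.\<close>

lemma sum_root_torus_rotate:
  assumes "\<omega> ^ N = 1" "N > 0"
  shows "(\<Sum>\<theta>\<in>root_torus N. g (\<theta>(i := \<omega> * \<theta> i))) = (\<Sum>\<theta>\<in>root_torus N. g \<theta>)"
proof -
  have [simp]: "\<omega> \<noteq> 0" using assms by (auto simp: power_0_left)
  show ?thesis
    using assms
    by (intro sum.reindex_bij_witness[of _ "\<lambda>\<theta>. \<theta>(i := \<theta> i / \<omega>)" "\<lambda>\<theta>. \<theta>(i := \<omega> * \<theta> i)"])
       (auto simp: root_torus_def PiE_def Pi_def power_mult_distrib power_divide)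
qed

lemma char_eval_rotate:
  "char_eval a (\<theta>(i := \<omega> * \<theta> i)) = \<omega> powi (a $ i) * char_eval a \<theta>"
  unfolding char_eval_def
  by (subst (1 2) prod.remove[of UNIV i]) (simp_all add: power_int_mult_distrib)

text \<open>The numbers \<open>cis (2 * pi * m / N)\<close> with \<open>m < N\<close> are distinct,
  so the root has order exactly \<open>N\<close>; negative exponents follow by inversion.\<close>

lemma primitive_root_powi:
  fixes v :: int
  assumes "N > 0" "\<bar>v\<bar> < int N" "cis (2 * pi / N) powi v = 1"
  shows "v = 0"
proof (rule ccontr)
  assume v: "v \<noteq> 0"
  have *: "cis (2 * pi * real m / real N) \<noteq> 1" if "0 < m" "m < N" for m
  proof
    assume "cis (2 * pi * real m / real N) = 1"
    moreover have "inj_on (\<lambda>k. cis (2 * pi * real k / real N)) {..<N}"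
      using Complex.bij_betw_roots_unity[OF assms(1)] by (simp add: bij_betw_def)
    ultimately have "m = 0" using that by (auto dest: inj_onD[of _ _ m 0])
    then show False using that by simp
  qed
  have "cis (2 * pi / N) powi \<bar>v\<bar> = 1"
    using assms(3) by (auto simp: abs_if power_int_minus)
  then have "cis (2 * pi / N) ^ nat \<bar>v\<bar> = 1"
    by (simp add: power_int_def)
  then have "cis (2 * pi * real (nat \<bar>v\<bar>) / real N) = 1"
    by (simp add: Complex.DeMoivre mult_ac)
  then show False using *[of "nat \<bar>v\<bar>"] v assms(2) by (simp add: nat_less_iff)
qed

lemma primitive_root_power: "N > 0 \<Longrightarrow> cis (2 * pi / N) ^ N = 1"
  by (simp add: Complex.DeMoivre)

text \<open>If some \<open>v $ i\<close> is nonzero, rotating that coordinate by a primitive root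
  multiplies the sum by a factor other than 1, so the sum is 0.\<close>

lemma char_eval_orthogonality:
  fixes v :: "int ^ 'd::finite"
  assumes N: "N > 0" and v: "\<And>i. \<bar>v $ i\<bar> < int N"
  shows "(\<Sum>\<theta>\<in>root_torus N. char_eval v \<theta>) = (if v = 0 then of_nat (card (root_torus N :: ('d \<Rightarrow> complex) set)) else 0)"
proof (cases "v = 0")
  case True
  then show ?thesis by (simp add: char_eval_def)
next
  case False
  then obtain i where i: "v $ i \<noteq> 0" by (auto simp: vec_eq_iff)
  let ?\<omega> = "cis (2 * pi / N)" and ?S = "\<Sum>\<theta>\<in>root_torus N. char_eval v \<theta>"
  have "?S = (\<Sum>\<theta>\<in>root_torus N. char_eval v (\<theta>(i := ?\<omega> * \<theta> i)))"
    by (rule sum_root_torus_rotate[OF primitive_root_power[OF N] N, symmetric])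
  also have "\<dots> = ?\<omega> powi (v $ i) * ?S"
    by (simp add: char_eval_rotate sum_distrib_left)
  finally have "?S = 0"
    using primitive_root_powi[OF N v[of i]] i unfolding mult_cancel_right1 by blast
  then show ?thesis using False by simp
qed

section \<open>Even moments of exponential sums\<close>

text \<open>Expanding \<open>k\<close> factors \<open>exp_sum A \<theta>\<close> and
  \<open>k\<close> conjugates gives one character for each \<open>2 * k\<close>-tuple, at its signed
  sum \<open>s f\<close>. Orthogonality keeps the tuples with \<open>s f = 0\<close>, which are
  those counted by the energy.\<close>

lemma sum_cmod_exp_sum:
  fixes A :: "(int ^ 'd::finite) set"
  assumes A: "finite A" "A \<subseteq> discrete_cube" and N: "k < N"
  shows "(\<Sum>\<theta>\<in>root_torus N. cmod (exp_sum A \<theta>) ^ (2 * k))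
    = real (card (root_torus N :: ('d \<Rightarrow> complex) set)) * real (additive_energy k A)"
proof -
  let ?T = "root_torus N :: ('d \<Rightarrow> complex) set" and ?P = "{1..2 * k} \<rightarrow>\<^sub>E A"
  define s where "s f = (\<Sum>i\<in>{1..2 * k}. if i \<le> k then f i else - f i)" for f :: "nat \<Rightarrow> int ^ 'd"
  have N0: "N > 0" using N by simp
  have split: "{1..2 * k} = {1..k} \<union> {k + 1..2 * k}" by auto
  have s: "s f = (\<Sum>i = 1..k. f i) - (\<Sum>i = k + 1..2 * k. f i)" for f
    unfolding s_def split by (subst sum.union_disjoint) (auto simp: sum_negf)
  have expand: "complex_of_real (cmod (exp_sum A \<theta>) ^ (2 * k)) = (\<Sum>f\<in>?P. char_eval (s f) \<theta>)"
    if \<theta>: "\<theta> \<in> ?T" for \<theta>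
  proof -
    have "complex_of_real (cmod (exp_sum A \<theta>) ^ (2 * k)) = exp_sum A \<theta> ^ k * cnj (exp_sum A \<theta>) ^ k"
      unfolding power_mult of_real_power[of "(cmod (exp_sum A \<theta>))\<^sup>2"] complex_norm_square
      by (simp add: power_mult_distrib)
    also have "\<dots> = (\<Prod>i\<in>{1..2 * k}. \<Sum>a\<in>A. char_eval (if i \<le> k then a else - a) \<theta>)"
      unfolding split
      by (subst prod.union_disjoint) (auto simp: exp_sum_def cnj_char_eval[OF \<theta> N0])
    also have "\<dots> = (\<Sum>f\<in>?P. \<Prod>i\<in>{1..2 * k}. char_eval (if i \<le> k then f i else - f i) \<theta>)"
      using A by (intro prod_sum_PiE) auto
    also have "\<dots> = (\<Sum>f\<in>?P. char_eval (s f) \<theta>)"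
      unfolding s_def by (simp add: char_eval_sum[OF \<theta> N0])
    finally show ?thesis .
  qed
  \<comment> \<open>Each half of the tuple sums to a value between 0 and \<open>k\<close> in every
    coordinate, so \<open>k < N\<close> rules out wrap-around.\<close>
  have small: "\<bar>s f $ j\<bar> < int N" if f: "f \<in> ?P" for f j
  proof -
    have b: "0 \<le> f i $ j \<and> f i $ j \<le> 1" if "i \<in> {1..2 * k}" for i
    proof -
      have "f i \<in> discrete_cube" using f that A(2) by (auto simp: PiE_def Pi_def)
      then have "f i $ j = 0 \<or> f i $ j = 1" by (simp add: discrete_cube_def)
      then show ?thesis by auto
    qed
    have "(\<Sum>i = 1..k. f i $ j) \<le> (\<Sum>i = 1..k. 1)" "(\<Sum>i = 1..k. f i $ j) \<ge> 0"
      using b by (intro sum_mono sum_nonneg; simp)+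
    moreover have "(\<Sum>i = k + 1..2 * k. f i $ j) \<le> (\<Sum>i = k + 1..2 * k. 1)"
        "(\<Sum>i = k + 1..2 * k. f i $ j) \<ge> 0"
      using b by (intro sum_mono sum_nonneg; simp)+
    ultimately show ?thesis using N by (simp add: s)
  qed
  have fin: "finite ?P" using A by (intro finite_PiE) auto
  have "complex_of_real (\<Sum>\<theta>\<in>?T. cmod (exp_sum A \<theta>) ^ (2 * k)) = (\<Sum>\<theta>\<in>?T. \<Sum>f\<in>?P. char_eval (s f) \<theta>)"
    using expand by (simp del: of_real_power)
  also have "\<dots> = (\<Sum>f\<in>?P. \<Sum>\<theta>\<in>?T. char_eval (s f) \<theta>)"
    by (rule sum.swap)
  also have "\<dots> = (\<Sum>f\<in>?P. if s f = 0 then of_nat (card ?T) else 0)"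
    using small by (intro sum.cong refl char_eval_orthogonality[OF N0]) auto
  also have "\<dots> = (\<Sum>f\<in>{f \<in> ?P. s f = 0}. of_nat (card ?T))"
    by (rule sum.inter_filter[OF fin, symmetric])
  also have "\<dots> = of_nat (card ?T) * of_nat (additive_energy k A)"
    by (simp add: additive_energy_def s mult.commute)
  finally have "complex_of_real (\<Sum>\<theta>\<in>?T. cmod (exp_sum A \<theta>) ^ (2 * k))
      = complex_of_real (real (card ?T) * real (additive_energy k A))"
    by (simp only: of_real_mult of_real_of_nat_eq)
  then show ?thesis by (simp only: of_real_eq_iff)
qed

text \<open>Rotating coordinate \<open>i\<close> multiplies the mixed terms with unequal exponents by a nontrivial
  root of unity, so only the diagonal terms of the binomial expansion survive.\<close>
lemma sum_cmod_exp_sum_split: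
  fixes A0 A1 :: "(int ^ 'd::finite) set"
  assumes A0: "finite A0" "\<And>a. a \<in> A0 \<Longrightarrow> a $ i = 0"
    and A1: "finite A1" "\<And>a. a \<in> A1 \<Longrightarrow> a $ i = 1" and N: "k < N"
  shows "(\<Sum>\<theta>\<in>root_torus N. cmod (exp_sum (A0 \<union> A1) \<theta>) ^ (2 * k))
    = (\<Sum>j\<le>k. (real (k choose j))\<^sup>2 *
        (\<Sum>\<theta>\<in>root_torus N. ((cmod (exp_sum A0 \<theta>))\<^sup>2) ^ (k - j) * ((cmod (exp_sum A1 \<theta>))\<^sup>2) ^ j))"
proof -
  let ?T = "root_torus N :: ('d \<Rightarrow> complex) set" and ?\<omega> = "cis (2 * pi / N)"
  define F0 F1 where "F0 = exp_sum A0" and "F1 = exp_sum A1"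
  have N0: "N > 0" using N by simp
  have "A0 \<inter> A1 = {}" using A0(2) A1(2) by force
  then have F: "exp_sum (A0 \<union> A1) \<theta> = F1 \<theta> + F0 \<theta>" for \<theta>
    using A0(1) A1(1) by (simp add: exp_sum_def sum.union_disjoint F0_def F1_def)
  define m where "m j \<theta> = of_nat (k choose j) * F1 \<theta> ^ j * F0 \<theta> ^ (k - j)" for j \<theta>
  define c where "c j l = (\<Sum>\<theta>\<in>?T. m j \<theta> * cnj (m l \<theta>))" for j l
  have rotate: "m j (\<theta>(i := ?\<omega> * \<theta> i)) = ?\<omega> ^ j * m j \<theta>" for j \<theta>
  proof -
    have "F0 (\<theta>(i := ?\<omega> * \<theta> i)) = F0 \<theta>" "F1 (\<theta>(i := ?\<omega> * \<theta> i)) = ?\<omega> * F1 \<theta>"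
      using A0(2) A1(2) by (simp_all add: F0_def F1_def exp_sum_def char_eval_rotate sum_distrib_left)
    then show ?thesis by (simp add: m_def power_mult_distrib mult_ac)
  qed
  have off: "c j l = 0" if "j \<le> k" "l \<le> k" "j \<noteq> l" for j l
  proof -
    have "c j l = (\<Sum>\<theta>\<in>?T. m j (\<theta>(i := ?\<omega> * \<theta> i)) * cnj (m l (\<theta>(i := ?\<omega> * \<theta> i))))"
      unfolding c_def
      by (rule sum_root_torus_rotate[OF primitive_root_power[OF N0] N0,
            where g = "\<lambda>\<theta>. m j \<theta> * cnj (m l \<theta>)", symmetric])
    also have "\<dots> = ?\<omega> ^ j * cnj (?\<omega> ^ l) * c j l"
      unfolding rotate c_def sum_distrib_left by (simp add: mult_ac)
    also have "?\<omega> ^ j * cnj (?\<omega> ^ l) = ?\<omega> powi (int j - int l)"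
      by (simp add: power_int_diff cis_cnj cis_inverse[symmetric] field_simps)
    finally have "c j l = ?\<omega> powi (int j - int l) * c j l" .
    \<comment> \<open>The indices differ by at most \<open>k\<close>, which is less than the order
      \<open>N\<close> of the root.\<close>
    moreover have "?\<omega> powi (int j - int l) \<noteq> 1"
      using primitive_root_powi[OF N0, of "int j - int l"] that N by linarith
    ultimately show ?thesis by simp
  qed
  have "complex_of_real (\<Sum>\<theta>\<in>?T. cmod (exp_sum (A0 \<union> A1) \<theta>) ^ (2 * k))
    = (\<Sum>\<theta>\<in>?T. (\<Sum>j\<le>k. m j \<theta>) * cnj (\<Sum>l\<le>k. m l \<theta>))"
    unfolding of_real_sum
  proof (rule sum.cong[OF refl])
    fix \<theta>
    have "(\<Sum>j\<le>k. m j \<theta>) = exp_sum (A0 \<union> A1) \<theta> ^ k"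
      unfolding m_def F by (rule binomial_ring[symmetric])
    moreover have "complex_of_real (cmod z ^ (2 * k)) = z ^ k * cnj (z ^ k)" for z
      unfolding power_mult of_real_power[of "(cmod z)\<^sup>2"] complex_norm_square
      by (simp add: power_mult_distrib)
    ultimately show "complex_of_real (cmod (exp_sum (A0 \<union> A1) \<theta>) ^ (2 * k))
        = (\<Sum>j\<le>k. m j \<theta>) * cnj (\<Sum>l\<le>k. m l \<theta>)"
      by presburger
  qed
  also have "\<dots> = (\<Sum>j\<le>k. \<Sum>l\<le>k. c j l)"
    unfolding c_def cnj_sum sum_product
    by (subst sum.swap, intro sum.cong refl sum.swap)
  also have "\<dots> = (\<Sum>j\<le>k. c j j)"
  proof (rule sum.cong[OF refl])
    fix j assume j: "j \<in> {..k}"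
    have "(\<Sum>l\<le>k. c j l) = (\<Sum>l\<in>{j}. c j l)"
      using off j by (intro sum.mono_neutral_right) auto
    then show "(\<Sum>l\<le>k. c j l) = c j j" by simp
  qed
  also have "\<dots> = complex_of_real (\<Sum>j\<le>k. (real (k choose j))\<^sup>2 *
        (\<Sum>\<theta>\<in>?T. ((cmod (F0 \<theta>))\<^sup>2) ^ (k - j) * ((cmod (F1 \<theta>))\<^sup>2) ^ j))"
    unfolding of_real_sum
  proof (rule sum.cong[OF refl])
    fix j
    have "m j \<theta> * cnj (m j \<theta>) = complex_of_real ((real (k choose j))\<^sup>2 *
        (((cmod (F0 \<theta>))\<^sup>2) ^ (k - j) * ((cmod (F1 \<theta>))\<^sup>2) ^ j))" for \<theta>
      unfolding of_real_mult of_real_power[of _ "k - j"] of_real_power[of _ j] complex_norm_square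
      by (simp add: m_def power_mult_distrib power2_eq_square mult_ac)
    then show "c j j = complex_of_real ((real (k choose j))\<^sup>2 *
        (\<Sum>\<theta>\<in>?T. ((cmod (F0 \<theta>))\<^sup>2) ^ (k - j) * ((cmod (F1 \<theta>))\<^sup>2) ^ j))"
      unfolding c_def sum_distrib_left of_real_sum by simp
  qed
  finally show ?thesis
    unfolding of_real_eq_iff F0_def F1_def .
qed

section \<open>Hoelder's inequality\<close>

lemma weighted_am_gm_power:
  fixes x y :: real
  assumes "x \<ge> 0" "y \<ge> 0" "j \<le> k" "k \<ge> 1"
  shows "x ^ (k - j) * y ^ j \<le> (1 - j / k) * x ^ k + j / k * y ^ k"
\<comment> \<open>Zero is treated apart since \<open>0 powr 0 = 0\<close> but
  \<open>0 ^ 0 = 1\<close>.\<close>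
proof (cases "x = 0 \<or> y = 0")
  case True
  then show ?thesis using assms
    by (cases "j = 0"; cases "j = k") (auto simp: power_0_left)
next
  case False
  with assms have xy: "x > 0" "y > 0" by auto
  have "(x ^ k) powr (1 - j / k) * (y ^ k) powr (j / k) \<le> (1 - j / k) * x ^ k + j / k * y ^ k"
    using assms xy by (intro Youngs_inequality_0) (auto simp: field_simps)
  moreover have "(x ^ k) powr (1 - j / k) = x ^ (k - j)"
    using assms xy by (simp add: powr_realpow[symmetric] powr_powr of_nat_diff right_diff_distrib)
  moreover have "(y ^ k) powr (j / k) = y ^ j"
    using assms xy by (simp add: powr_realpow[symmetric] powr_powr)
  ultimately show ?thesis by simp
qed

text \<open>After dividing by \<open>X\<close> and \<open>Y\<close>, the pointwise inequality can be
  summed; its weights add up to 1, which leaves \<open>M\<close>. Upper bounds replace the exact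
  norms so that an induction hypothesis can be inserted directly.\<close>

lemma sum_power_Hoelder:
  fixes u v :: "'a \<Rightarrow> real"
  assumes nonneg: "\<And>x. x \<in> T \<Longrightarrow> u x \<ge> 0" "\<And>x. x \<in> T \<Longrightarrow> v x \<ge> 0"
    and pos: "X > 0" "Y > 0" and jk: "j \<le> k" "k \<ge> 1"
    and u: "(\<Sum>x\<in>T. u x ^ k) \<le> M * X ^ k" and v: "(\<Sum>x\<in>T. v x ^ k) \<le> M * Y ^ k"
  shows "(\<Sum>x\<in>T. u x ^ (k - j) * v x ^ j) \<le> M * (X ^ (k - j) * Y ^ j)"
proof -
  let ?\<alpha> = "1 - real j / real k" and ?\<beta> = "real j / real k"
  have \<alpha>: "?\<alpha> \<ge> 0" using jk by simp
  have "(\<Sum>x\<in>T. u x ^ (k - j) * v x ^ j) / (X ^ (k - j) * Y ^ j)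
    = (\<Sum>x\<in>T. (u x / X) ^ (k - j) * (v x / Y) ^ j)"
    by (simp add: sum_divide_distrib power_divide)
  also have "\<dots> \<le> (\<Sum>x\<in>T. ?\<alpha> * (u x / X) ^ k + ?\<beta> * (v x / Y) ^ k)"
    using nonneg pos jk by (intro sum_mono weighted_am_gm_power) auto
  also have "\<dots> = ?\<alpha> * ((\<Sum>x\<in>T. u x ^ k) / X ^ k) + ?\<beta> * ((\<Sum>x\<in>T. v x ^ k) / Y ^ k)"
    by (simp add: sum.distrib sum_distrib_left sum_divide_distrib power_divide)
  also have "\<dots> \<le> ?\<alpha> * M + ?\<beta> * M"
    using u v pos \<alpha> by (intro add_mono mult_left_mono) (auto simp: divide_le_eq)
  also have "\<dots> = M" by (simp add: algebra_simps)
  finally show ?thesis using pos by (simp add: divide_le_eq)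
qed

section \<open>Induction on the size of the set\<close>

text \<open>The bound is stated for moments rather than energies because Hoelder's inequality acts
  on the moments of the two halves. The halves may have any smaller size, hence the strong
  induction.\<close>

lemma sum_cmod_exp_sum_le:
  fixes A :: "(int ^ 'd::finite) set"
  assumes k: "k \<ge> 1" and N: "k < N" and A: "finite A" "A \<subseteq> discrete_cube"
    and p_def: "p = log 2 (real ((2 * k) choose k))"
  shows "(\<Sum>\<theta>\<in>root_torus N. cmod (exp_sum A \<theta>) ^ (2 * k))
    \<le> real (card (root_torus N :: ('d \<Rightarrow> complex) set)) * real (card A) powr p"
  using A
proof (induction "card A" arbitrary: A rule: less_induct)
  case less
  let ?T = "root_torus N :: ('d \<Rightarrow> complex) set"
  show ?case
  proof (cases "\<exists>a\<in>A. \<exists>b\<in>A. a \<noteq> b")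
    case False
    then consider "A = {}" | a where "A = {a}" by blast
    then show ?thesis
    proof cases
      case 1
      \<comment> \<open>Both sides vanish: \<open>k \<ge> 1\<close> makes the power of 0 zero, and
        \<open>0 powr p = 0\<close>.\<close>
      then show ?thesis using k by (simp add: exp_sum_def power_0_left)
    next
      case 2
      have "cmod (exp_sum A \<theta>) = 1" if "\<theta> \<in> ?T" for \<theta>
        using root_torusD[OF that] N
        by (simp add: 2 exp_sum_def char_eval_def prod_norm[symmetric] norm_power_int)
      then show ?thesis using 2 by simp
    qed
  next
    case True
    \<comment> \<open>Splitting along a coordinate where two points differ makes both halves
      nonempty, hence strictly smaller than \<open>A\<close>.\<close>
    then obtain a b i where ab: "a \<in> A" "b \<in> A" "a $ i \<noteq> b $ i"
      by (auto simp: vec_eq_iff)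
    define A0 A1 where "A0 = {x \<in> A. x $ i = 0}" and "A1 = {x \<in> A. x $ i = 1}"
    have val: "x $ i = 0 \<or> x $ i = 1" if "x \<in> A" for x
      using that less.prems(2) by (auto simp: discrete_cube_def)
    then have A_eq: "A = A0 \<union> A1" by (auto simp: A0_def A1_def)
    have disj: "A0 \<inter> A1 = {}" by (auto simp: A0_def A1_def)
    have fin: "finite A0" "finite A1" and cube: "A0 \<subseteq> discrete_cube" "A1 \<subseteq> discrete_cube"
      using less.prems by (auto simp: A0_def A1_def)
    have "A0 \<noteq> {}" "A1 \<noteq> {}"
      using ab val[of a] val[of b] by (auto simp: A0_def A1_def)
    then have pos: "card A0 > 0" "card A1 > 0" using fin by (auto simp: card_gt_0_iff)
    have card: "card A = card A0 + card A1"
      unfolding A_eq using fin disj by (rule card_Un_disjoint)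
    \<comment> \<open>These are the \<open>k\<close>-th roots of the inductive bounds, the form
      shared by \<open>sum_power_Hoelder\<close> and \<open>two_point_inequality\<close>.\<close>
    define X Y where "X = real (card A0) powr (p / k)" and "Y = real (card A1) powr (p / k)"
    have XY: "X > 0" "Y > 0" using pos by (auto simp: X_def Y_def)
    have "X ^ k = real (card A0) powr p" "Y ^ k = real (card A1) powr p"
      using k pos XY by (simp_all add: X_def Y_def powr_realpow[symmetric] powr_powr)
    then have IH: "(\<Sum>\<theta>\<in>?T. ((cmod (exp_sum A0 \<theta>))\<^sup>2) ^ k) \<le> card ?T * X ^ k"
      "(\<Sum>\<theta>\<in>?T. ((cmod (exp_sum A1 \<theta>))\<^sup>2) ^ k) \<le> card ?T * Y ^ k"
      using less.hyps[of A0] less.hyps[of A1] fin cube pos card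
      by (simp_all add: power_mult)
    have "(\<Sum>\<theta>\<in>?T. cmod (exp_sum A \<theta>) ^ (2 * k))
      = (\<Sum>j\<le>k. (real (k choose j))\<^sup>2 *
        (\<Sum>\<theta>\<in>?T. ((cmod (exp_sum A0 \<theta>))\<^sup>2) ^ (k - j) * ((cmod (exp_sum A1 \<theta>))\<^sup>2) ^ j))"
      unfolding A_eq using fin N
      by (intro sum_cmod_exp_sum_split[where i = i]) (auto simp: A0_def A1_def)
    also have "\<dots> \<le> (\<Sum>j\<le>k. (real (k choose j))\<^sup>2 * (card ?T * (X ^ (k - j) * Y ^ j)))"
      using IH XY k by (intro sum_mono mult_left_mono sum_power_Hoelder) auto
    also have "\<dots> = card ?T * (\<Sum>j\<le>k. (real (k choose j))\<^sup>2 * (X ^ (k - j) * Y ^ j))"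
      by (simp add: sum_distrib_left mult_ac)
    also have "\<dots> \<le> card ?T * (real (card A0) + real (card A1)) powr p"
      unfolding X_def Y_def using two_point_inequality[OF k _ _ p_def, of "card A0" "card A1"] pos
      by (intro mult_left_mono) auto
    finally show ?thesis by (simp add: card)
  qed
qed

section \<open>From moments back to the energy\<close>

lemma finite_discrete_cube: "finite (discrete_cube :: (int ^ 'd::finite) set)"
proof -
  have "discrete_cube \<subseteq> vec_lambda ` (UNIV \<rightarrow>\<^sub>E {0, 1} :: ('d \<Rightarrow> int) set)"
  proof
    fix x :: "int ^ 'd"
    assume "x \<in> discrete_cube"
    then show "x \<in> vec_lambda ` (UNIV \<rightarrow>\<^sub>E {0, 1} :: ('d \<Rightarrow> int) set)"
      by (intro image_eqI[of _ _ "vec_nth x"]) (auto simp: discrete_cube_def vec_nth_inverse)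
  qed
  then show ?thesis
    by (rule finite_subset) (intro finite_imageI finite_PiE; simp)
qed

theorem corollary2:
  fixes k :: nat and A :: "(int ^ 'd::finite) set"
  assumes "k \<ge> 1" and "A \<subseteq> discrete_cube"
  shows "real (additive_energy k A) \<le> real (card A) powr (log 2 (real ((2 * k) choose k)))"
proof -
  have A: "finite A" using assms(2) finite_discrete_cube by (rule finite_subset)
  \<comment> \<open>The smallest order allowed by \<open>k < N\<close> is taken; the cardinality of
    the group then cancels.\<close>
  let ?T = "root_torus (k + 1) :: ('d \<Rightarrow> complex) set"
  have "real (card ?T) * real (additive_energy k A)
      \<le> real (card ?T) * real (card A) powr (log 2 (real ((2 * k) choose k)))"
    using sum_cmod_exp_sum[of A k "k + 1"] sum_cmod_exp_sum_le[OF assms(1) _ A assms(2) refl, of "k + 1"] A assms(2)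
    by simp
  moreover have "card ?T > 0" by (rule card_root_torus_pos) simp
  ultimately show ?thesis by simp
qed

end
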